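(* Consider Thiele's method (party version) for a set $\mathcal P=\{1,\dots,N\}$ of $N$ parties with some given numbers of votes $\{v_\sigma\}_{\sigma\subseteq\mathcal P}$. For a vector $(x_1,\dots,x_N)$, define $x_\sigma:=\sum_{i\in\sigma}x_i$ for $\sigma\subseteq\mathcal P$. If the system of $N-1$ equations $$\sum_{\sigma\ni1}\frac{v_\sigma}{x_\sigma}=\sum_{\sigma\ni2}\frac{v_\sigma}{x_\sigma}=\dots=\sum_{\sigma\ni N}\frac{v_\sigma}{x_\sigma}$$ has a unique solution $\mathbf x_0$ in the open simplex $\mathfrak S^\circ=\{(x_1,\dots,x_N):x_i>0\text{ for all }i,\ \sum_{i=1}^Nx_i=1\}$, then $\mathbf p_n\to\mathbf x_0$ as $n\to\infty$.
   Context: Thiele's method, party version: for each $\sigma\subseteq\mathcal P$, $v_\sigma\ge0$ is the (fixed) number of votes for the set $\sigma$ of parties. Seats are awarded one at a time. At each stage let $n_i$ be the number of seats so far awarded to party $i$ (initially $0$) and $n_\sigma:=\sum_{i\in\sigma}n_i$. The next seat goes to a party $i$ with the largest value of $W_i:=\sum_{\sigma\ni i}\frac{v_\sigma}{1+n_\sigma}$, ties being broken in an arbitrary way; each party may receive arbitrarily many seats. After $n\ge1$ seats have been distributed, $\mathbf p_n:=(n_1/n,\dots,n_N/n)$ is the vector of proportions of seats. *)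

theory Defs
  imports "HOL-Analysis.Analysis"
begin

text \<open>
  The set of parties is an arbitrary finite type \<open>'n\<close>, so that \<open>N = CARD('n)\<close>;
  the votes are a function \<open>v :: 'n set \<Rightarrow> real\<close>. An election is described by the sequence
  \<open>a :: nat \<Rightarrow> 'n\<close> of awards: \<open>a k\<close> is the party that receives the seat awarded after
  \<open>k\<close> seats have already been distributed.
\<close>

definition seats :: "(nat \<Rightarrow> 'n) \<Rightarrow> nat \<Rightarrow> 'n \<Rightarrow> nat" where
  "seats a k i = card {j. j < k \<and> a j = i}"

definition thiele_weight :: "('n::finite set \<Rightarrow> real) \<Rightarrow> ('n \<Rightarrow> nat) \<Rightarrow> 'n \<Rightarrow> real" where
  "thiele_weight v n i = (\<Sum>\<sigma> | i \<in> \<sigma>. v \<sigma> / (1 + real (\<Sum>j\<in>\<sigma>. n j)))"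

text \<open>
  Arbitrary tie-breaking: any sequence of awards that always picks some maximizer of the weight
  is a possible outcome.
\<close>

definition thiele_sequence :: "('n::finite set \<Rightarrow> real) \<Rightarrow> (nat \<Rightarrow> 'n) \<Rightarrow> bool" where
  "thiele_sequence v a \<longleftrightarrow>
     (\<forall>k i. thiele_weight v (seats a k) i \<le> thiele_weight v (seats a k) (a k))"

text \<open>Meaningful for \<open>k \<ge> 1\<close> only.\<close>

definition seat_proportions :: "(nat \<Rightarrow> 'n::finite) \<Rightarrow> nat \<Rightarrow> real ^ 'n" where
  "seat_proportions a k = (\<chi> i. real (seats a k i) / real k)"

definition open_simplex :: "(real ^ 'n::finite) set" where
  "open_simplex = {x. (\<forall>i. x $ i > 0) \<and> (\<Sum>i\<in>UNIV. x $ i) = 1}"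

definition set_value :: "real ^ 'n::finite \<Rightarrow> 'n set \<Rightarrow> real" where
  "set_value x \<sigma> = (\<Sum>i\<in>\<sigma>. x $ i)"

text \<open>
  On the open simplex all denominators below are positive, since only sets \<open>\<sigma>\<close>
  containing \<open>i\<close> (or \<open>j\<close>) occur.
\<close>

definition balanced :: "('n::finite set \<Rightarrow> real) \<Rightarrow> real ^ 'n \<Rightarrow> bool" where
  "balanced v x \<longleftrightarrow>
     (\<forall>i j. (\<Sum>\<sigma> | i \<in> \<sigma>. v \<sigma> / set_value x \<sigma>) = (\<Sum>\<sigma> | j \<in> \<sigma>. v \<sigma> / set_value x \<sigma>))"

end

theory Submission
  imports Defs
begin

text \<open>
  The balanced point \<open>x\<close> is compared with the seats through the relative entropy
  \<open>E k = \<Sum> v \<sigma> * ln (k * x \<sigma> / (n \<sigma> + 1))\<close>. Choosing the party of maximal weight is at least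
  as good as averaging the weights with respect to \<open>x\<close>; together with \<open>ln t \<le> t - 1\<close> this gives
  \<open>k * E (k + 1) \<le> (k - 1) * E k + k * d k\<close>, where the error \<open>d k\<close> comes from the second-order
  term of the logarithm and telescopes to a convergent series. Hence \<open>limsup E \<le> 0\<close>.
  Since \<open>x\<close> is balanced, \<open>ln t \<le> t - 1 - (sqrt t - 1)\<^sup>2\<close> turns this into
  \<open>p \<sigma> \<longlonglongrightarrow> x \<sigma>\<close> for every set \<open>\<sigma>\<close> with a positive number of votes. These values determine a point
  of the closed simplex: if \<open>q\<close> has the same ones, then the midpoint of \<open>q\<close> and \<open>x\<close> is a balanced
  point of the open simplex, so it is \<open>x\<close>. Compactness finishes the proof.
\<close>

section \<open>Real inequalities: a damped recursion and a sharpened logarithm bound\<close>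

text \<open>The recursion telescopes: from \<open>M\<close> on,
  \<open>(k - 1) * (e k + b k - b M)\<close> does not increase. So \<open>e k\<close> is at most
  \<open>C / (k - 1)\<close> plus \<open>b M - b k\<close>, and the latter is small because
  \<open>b\<close> converges.\<close>

lemma damped_recursion_eventually_less:
  fixes e b :: "nat \<Rightarrow> real"
  assumes step: "\<And>k. k \<ge> 1 \<Longrightarrow>
      real k * e (Suc k) \<le> (real k - 1) * e k + real k * (b k - b (Suc k))"
    and b: "decseq b" "convergent b" and "\<epsilon> > 0"
  shows "\<forall>\<^sub>F k in sequentially. e k < \<epsilon>"
proof -
  obtain L where L: "b \<longlonglongrightarrow> L"
    using b(2) by (auto simp: convergent_def)
  have L_le: "L \<le> b k" for k
    using decseq_ge[OF b(1) L] .
  have "\<forall>\<^sub>F k in sequentially. b k < L + \<epsilon> / 2"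
    using order_tendstoD(2)[OF L, of "L + \<epsilon> / 2"] \<open>\<epsilon> > 0\<close> by simp
  then obtain M0 where M0: "\<And>k. k \<ge> M0 \<Longrightarrow> b k < L + \<epsilon> / 2"
    by (auto simp: eventually_sequentially)
  \<comment> \<open>\<open>Suc\<close> ensures \<open>M \<ge> 1\<close>, since the recursion is only
    assumed from 1 on.\<close>
  define M where "M = Suc M0"
  have bM: "b M < L + \<epsilon> / 2"
    using M0 by (simp add: M_def)
  define C where "C = (real M - 1) * e M"
  have bound: "(real k - 1) * (e k + b k - b M) \<le> C" if "k \<ge> M" for k
    using that
  proof (induction k rule: dec_induct)
    case base
    show ?case by (simp add: C_def)
  next
    case (step k)
    have "k \<ge> 1" using step.hyps by (simp add: M_def)
    have "b k \<le> b M"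
      using b(1) step.hyps by (simp add: decseq_def)
    have "(real (Suc k) - 1) * (e (Suc k) + b (Suc k) - b M)
        \<le> (real k - 1) * (e k + b k - b M) + (b k - b M)"
      using assms(1)[OF \<open>k \<ge> 1\<close>] by (simp add: algebra_simps)
    with step.IH \<open>b k \<le> b M\<close> show ?case by linarith
  qed
  \<comment> \<open>Chosen so that \<open>\<bar>C\<bar> / (k - 1) < \<epsilon> / 2\<close> once
    \<open>k - 1 \<ge> K\<close>.\<close>
  obtain K :: nat where K: "2 * \<bar>C\<bar> / \<epsilon> < real K"
    using reals_Archimedean2 by blast
  have "e k < \<epsilon>" if k: "k \<ge> M + K + 2" for k
  proof (rule ccontr)
    assume "\<not> e k < \<epsilon>"
    then have "\<epsilon> / 2 \<le> e k + b k - b M"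
      using bM L_le[of k] by simp
    then have "(real k - 1) * (\<epsilon> / 2) \<le> (real k - 1) * (e k + b k - b M)"
      using k by (intro mult_left_mono) auto
    also have "\<dots> \<le> C" using bound k by simp
    finally have "(real k - 1) * \<epsilon> \<le> 2 * \<bar>C\<bar>" by linarith
    moreover have "real K * \<epsilon> \<le> (real k - 1) * \<epsilon>"
      using k \<open>\<epsilon> > 0\<close> by (intro mult_right_mono) auto
    moreover have "2 * \<bar>C\<bar> < real K * \<epsilon>"
      using K \<open>\<epsilon> > 0\<close> by (simp add: divide_simps)
    ultimately show False by linarith
  qed
  then show ?thesis
    unfolding eventually_sequentially by blast
qed

text \<open>Applying \<open>ln u \<le> u - 1\<close> at \<open>u = sqrt t\<close> rather than at
  \<open>t\<close> leaves a square to spare, which measures how far \<open>t\<close> is from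
  1.\<close>

lemma ln_le_minus_sqrt_square:
  fixes t :: real
  assumes "t > 0"
  shows "ln t \<le> t - 1 - (sqrt t - 1)\<^sup>2"
proof -
  have "ln t = 2 * ln (sqrt t)"
    using assms by (simp add: ln_sqrt)
  also have "\<dots> \<le> 2 * (sqrt t - 1)"
    using ln_le_minus_one[of "sqrt t"] assms by simp
  also have "\<dots> = t - 1 - (sqrt t - 1)\<^sup>2"
    using assms by (simp add: power2_eq_square algebra_simps)
  finally show ?thesis .
qed

section \<open>Double counting and balanced points\<close>

text \<open>Double counting of pairs of a party and a set containing it; the empty set drops out
  because its value is 0.\<close>

lemma sum_set_value_swap:
  fixes f :: "'n::finite set \<Rightarrow> real"
  shows "(\<Sum>i\<in>UNIV. x $ i * (\<Sum>\<sigma> | i \<in> \<sigma>. f \<sigma>)) = (\<Sum>\<sigma> | \<sigma> \<noteq> {}. f \<sigma> * set_value x \<sigma>)"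
proof -
  have "(\<Sum>i\<in>UNIV. x $ i * (\<Sum>\<sigma> | i \<in> \<sigma>. f \<sigma>))
      = (\<Sum>i\<in>UNIV. \<Sum>\<sigma>\<in>UNIV. if i \<in> \<sigma> then x $ i * f \<sigma> else 0)"
    by (simp add: sum_distrib_left sum.If_cases)
  also have "\<dots> = (\<Sum>\<sigma>\<in>UNIV. \<Sum>i\<in>UNIV. if i \<in> \<sigma> then x $ i * f \<sigma> else 0)"
    by (rule sum.swap)
  also have "\<dots> = (\<Sum>\<sigma>\<in>UNIV. f \<sigma> * set_value x \<sigma>)"
    by (simp add: sum.If_cases set_value_def sum_distrib_left mult.commute)
  also have "\<dots> = (\<Sum>\<sigma> | \<sigma> \<noteq> {}. f \<sigma> * set_value x \<sigma>)"
    by (rule sum.mono_neutral_right) (auto simp: set_value_def)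
  finally show ?thesis .
qed

lemma set_value_pos:
  assumes "x \<in> open_simplex" "\<sigma> \<noteq> {}"
  shows "set_value x \<sigma> > 0"
  using assms unfolding set_value_def open_simplex_def by (intro sum_pos) auto

text \<open>Balance says that the left side, as a linear functional of \<open>q\<close>, has equal
  coefficients. It is therefore constant on the hyperplane of coordinate sum 1, and its value is
  read off at \<open>q = x\<close>.\<close>

lemma balanced_weighted_sum:
  assumes x: "x \<in> open_simplex" "balanced v x" and q: "(\<Sum>i\<in>UNIV. q $ i) = 1"
  shows "(\<Sum>\<sigma> | \<sigma> \<noteq> {}. v \<sigma> / set_value x \<sigma> * set_value q \<sigma>) = (\<Sum>\<sigma> | \<sigma> \<noteq> {}. v \<sigma>)"
proof -
  obtain c where c: "\<And>i. (\<Sum>\<sigma> | i \<in> \<sigma>. v \<sigma> / set_value x \<sigma>) = c"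
    using x(2) unfolding balanced_def by metis
  have val: "(\<Sum>\<sigma> | \<sigma> \<noteq> {}. v \<sigma> / set_value x \<sigma> * set_value y \<sigma>) = c"
    if "(\<Sum>i\<in>UNIV. y $ i) = 1" for y
    unfolding sum_set_value_swap[symmetric] c sum_distrib_right[symmetric] that by simp
  have "(\<Sum>\<sigma> | \<sigma> \<noteq> {}. v \<sigma> / set_value x \<sigma> * set_value x \<sigma>) = (\<Sum>\<sigma> | \<sigma> \<noteq> {}. v \<sigma>)"
    using set_value_pos[OF x(1)] by (intro sum.cong) (auto simp: less_imp_neq[symmetric])
  with val[of x] val[of q] q x(1) show ?thesis by (simp add: open_simplex_def)
qed

section \<open>Seat counts and the entropy recursion\<close>

lemma seats_Suc: "seats a (Suc k) i = seats a k i + of_bool (a k = i)"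
proof -
  have "{j. j < Suc k \<and> a j = i} = {j. j < k \<and> a j = i} \<union> (if a k = i then {k} else {})"
    by (auto simp: less_Suc_eq)
  then show ?thesis by (simp add: seats_def)
qed

lemma sum_seats_Suc:
  fixes a :: "nat \<Rightarrow> 'n::finite"
  shows "(\<Sum>i\<in>\<sigma>. seats a (Suc k) i) = (\<Sum>i\<in>\<sigma>. seats a k i) + of_bool (a k \<in> \<sigma>)"
  by (simp add: seats_Suc sum.distrib of_bool_def)

lemma sum_seats_UNIV:
  fixes a :: "nat \<Rightarrow> 'n::finite"
  shows "(\<Sum>i\<in>UNIV. seats a k i) = k"
  by (induction k) (simp_all add: sum_seats_Suc, simp add: seats_def)

text \<open>Here \<open>s k \<sigma>\<close> is the denominator in the weights. One more seat raises
  \<open>ln k\<close> by at most \<open>1 / k\<close>, and raises \<open>ln (s k \<sigma>)\<close>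
  by about \<open>1 / s k \<sigma>\<close> for the sets containing the winner only. The latter
  gains, weighted by votes, add up to the winning weight; \<open>b\<close> absorbs the second-order
  error.\<close>

lemma thiele_entropy_step:
  fixes v :: "'n::finite set \<Rightarrow> real" and a :: "nat \<Rightarrow> 'n" and x :: "real ^ 'n"
  defines "s \<equiv> \<lambda>k \<sigma>. real (\<Sum>i\<in>\<sigma>. seats a k i) + 1"
  defines "E \<equiv> \<lambda>k. \<Sum>\<sigma> | \<sigma> \<noteq> {}. v \<sigma> * ln (real k * set_value x \<sigma> / s k \<sigma>)"
  defines "b \<equiv> \<lambda>k. \<Sum>\<sigma> | \<sigma> \<noteq> {}. v \<sigma> * (2 / s k \<sigma>)"
  assumes v: "\<And>\<sigma>. v \<sigma> \<ge> 0" and a: "thiele_sequence v a" and x: "x \<in> open_simplex"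
    and k: "k \<ge> 1"
  shows "real k * E (Suc k) \<le> (real k - 1) * E k + real k * (b k - b (Suc k))"
proof -
  let ?r = "\<lambda>\<sigma>. real k * set_value x \<sigma> / s k \<sigma>"
  have s: "s k \<sigma> \<ge> 1" for k \<sigma> by (simp add: s_def del: of_nat_sum)
  have s_Suc: "s (Suc k) \<sigma> = s k \<sigma> + of_bool (a k \<in> \<sigma>)" for \<sigma>
    by (simp add: s_def sum_seats_Suc del: of_nat_sum)
  have W: "thiele_weight v (seats a k) i = (\<Sum>\<sigma> | i \<in> \<sigma>. v \<sigma> / s k \<sigma>)" for i
    by (simp add: thiele_weight_def s_def add.commute)
  have x_nonneg: "x $ i \<ge> 0" for i
    using x by (simp add: open_simplex_def less_imp_le)
  have log_step: "ln (real (Suc k) * set_value x \<sigma> / s (Suc k) \<sigma>)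
      \<le> ln (?r \<sigma>) + 1 / k - of_bool (a k \<in> \<sigma>) / s k \<sigma> + (2 / s k \<sigma> - 2 / s (Suc k) \<sigma>)"
    if "\<sigma> \<noteq> {}" for \<sigma>
  proof -
    have pos: "set_value x \<sigma> > 0" "s k \<sigma> > 0" "s (Suc k) \<sigma> > 0"
      using set_value_pos[OF x that] s[of k \<sigma>] s[of "Suc k" \<sigma>] by auto
    have "ln (real (Suc k) * set_value x \<sigma> / s (Suc k) \<sigma>)
        = ln (?r \<sigma>) + (ln (Suc k) - ln k) - (ln (s (Suc k) \<sigma>) - ln (s k \<sigma>))"
      using pos k by (simp add: ln_mult ln_div)
    moreover have "ln (Suc k) - ln k \<le> 1 / real k"
    proof -
      have "ln (Suc k) - ln k = ln (1 + 1 / real k)"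
        using k ln_div[of "real (Suc k)" "real k"] by (simp add: field_simps)
      then show ?thesis using ln_add_one_self_le_self[of "1 / real k"] by simp
    qed
    moreover have "of_bool (a k \<in> \<sigma>) / s k \<sigma> - (2 / s k \<sigma> - 2 / s (Suc k) \<sigma>)
        \<le> ln (s (Suc k) \<sigma>) - ln (s k \<sigma>)"
    proof (cases "a k \<in> \<sigma>")
      case True
      define u where "u = s k \<sigma>"
      have u: "u \<ge> 1" using s by (simp add: u_def)
      have "ln (u + 1) - ln u = ln (1 + 1 / u)"
        using u ln_div[of "u + 1" u] by (simp add: field_simps)
      also have "\<dots> \<ge> 1 / u - (1 / u)\<^sup>2"
        using u by (intro ln_one_plus_pos_lower_bound) auto
      \<comment> \<open>The right side is \<open>2 / (u * (u + 1))\<close>, and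
        \<open>u + 1 \<le> 2 * u\<close> as \<open>u \<ge> 1\<close>. This is the origin of the
        factor 2 in \<open>b\<close>.\<close>
      also have "(1 / u)\<^sup>2 \<le> 2 / u - 2 / (u + 1)"
        using u by (simp add: divide_simps power2_eq_square)
      ultimately show ?thesis using True by (simp add: s_Suc u_def)
    qed (simp add: s_Suc)
    ultimately show ?thesis by linarith
  qed
  have "E (Suc k) \<le> (\<Sum>\<sigma> | \<sigma> \<noteq> {}. v \<sigma> * (ln (?r \<sigma>) + 1 / k - of_bool (a k \<in> \<sigma>) / s k \<sigma>
      + (2 / s k \<sigma> - 2 / s (Suc k) \<sigma>)))"
    unfolding E_def by (intro sum_mono mult_left_mono log_step v) auto
  also have "\<dots> = E k + (\<Sum>\<sigma> | \<sigma> \<noteq> {}. v \<sigma> / k)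
      - (\<Sum>\<sigma> | \<sigma> \<noteq> {}. v \<sigma> * (of_bool (a k \<in> \<sigma>) / s k \<sigma>)) + (b k - b (Suc k))"
    unfolding E_def b_def
    by (simp add: sum.distrib sum_subtractf right_diff_distrib distrib_left)
  also have "(\<Sum>\<sigma> | \<sigma> \<noteq> {}. v \<sigma> * (of_bool (a k \<in> \<sigma>) / s k \<sigma>))
      = thiele_weight v (seats a k) (a k)"
    unfolding W by (rule sum.mono_neutral_cong_right) auto
  finally have "E (Suc k) \<le> E k + (\<Sum>\<sigma> | \<sigma> \<noteq> {}. v \<sigma> / k)
      - thiele_weight v (seats a k) (a k) + (b k - b (Suc k))" .
  \<comment> \<open>The largest weight is at least the average with respect to the probability
    vector \<open>x\<close>, which double counting rewrites as a sum over sets.\<close>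
  moreover have "(\<Sum>\<sigma> | \<sigma> \<noteq> {}. v \<sigma> / s k \<sigma> * set_value x \<sigma>)
      \<le> thiele_weight v (seats a k) (a k)"
  proof -
    have "(\<Sum>\<sigma> | \<sigma> \<noteq> {}. v \<sigma> / s k \<sigma> * set_value x \<sigma>)
        = (\<Sum>i\<in>UNIV. x $ i * thiele_weight v (seats a k) i)"
      by (simp add: W sum_set_value_swap)
    also have "\<dots> \<le> (\<Sum>i\<in>UNIV. x $ i * thiele_weight v (seats a k) (a k))"
      using a x_nonneg by (intro sum_mono mult_left_mono) (auto simp: thiele_sequence_def)
    also have "\<dots> = thiele_weight v (seats a k) (a k)"
      using x by (simp add: open_simplex_def sum_distrib_right[symmetric])
    finally show ?thesis .
  qed
  ultimately have "E (Suc k) \<le> E k + (\<Sum>\<sigma> | \<sigma> \<noteq> {}. v \<sigma> / k)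
      - (\<Sum>\<sigma> | \<sigma> \<noteq> {}. v \<sigma> / s k \<sigma> * set_value x \<sigma>) + (b k - b (Suc k))" by linarith
  then have "real k * E (Suc k) \<le> real k * (E k + (\<Sum>\<sigma> | \<sigma> \<noteq> {}. v \<sigma> / k)
      - (\<Sum>\<sigma> | \<sigma> \<noteq> {}. v \<sigma> / s k \<sigma> * set_value x \<sigma>) + (b k - b (Suc k)))"
    by (intro mult_left_mono) auto
  also have "\<dots> = real k * E k + (\<Sum>\<sigma> | \<sigma> \<noteq> {}. v \<sigma> * (1 - ?r \<sigma>)) + real k * (b k - b (Suc k))"
  proof -
    have "real k * (\<Sum>\<sigma> | \<sigma> \<noteq> {}. v \<sigma> / k) = (\<Sum>\<sigma> | \<sigma> \<noteq> {}. v \<sigma>)"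
      using k by (simp add: sum_distrib_left)
    moreover have "real k * (\<Sum>\<sigma> | \<sigma> \<noteq> {}. v \<sigma> / s k \<sigma> * set_value x \<sigma>)
        = (\<Sum>\<sigma> | \<sigma> \<noteq> {}. v \<sigma> * ?r \<sigma>)"
      unfolding sum_distrib_left by (intro sum.cong) auto
    ultimately show ?thesis
      by (simp add: algebra_simps sum_subtractf)
  qed
  \<comment> \<open>This is the source of the damping: it lowers the coefficient of
    \<open>E k\<close> from \<open>k\<close> to \<open>k - 1\<close>.\<close>
  also have "(\<Sum>\<sigma> | \<sigma> \<noteq> {}. v \<sigma> * (1 - ?r \<sigma>)) \<le> - E k"
  proof -
    have "v \<sigma> * (1 - ?r \<sigma>) \<le> v \<sigma> * - ln (?r \<sigma>)" if "\<sigma> \<noteq> {}" for \<sigma>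
    proof -
      have "?r \<sigma> > 0"
        using set_value_pos[OF x that] s[of k \<sigma>] k by (intro divide_pos_pos mult_pos_pos) auto
      then show ?thesis
        using ln_le_minus_one[of "?r \<sigma>"] v by (intro mult_left_mono) auto
    qed
    then show ?thesis
      unfolding E_def sum_negf[symmetric] by (intro sum_mono) auto
  qed
  finally show ?thesis by (simp add: algebra_simps)
qed

section \<open>Convergence of the set values\<close>

lemma set_value_seat_proportions:
  "set_value (seat_proportions a k) \<sigma> = real (\<Sum>i\<in>\<sigma>. seats a k i) / real k"
  by (simp add: set_value_def seat_proportions_def sum_divide_distrib)

text \<open>The entropy dominates, up to \<open>B / k\<close>, a sum of nonnegative squares weighted
  by votes. An upper bound tending to 0 thus forces each square with positive votes to 0.\<close>

lemma thiele_set_value_tendsto: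
  fixes v :: "'n::finite set \<Rightarrow> real" and a :: "nat \<Rightarrow> 'n" and x :: "real ^ 'n"
  assumes v: "\<And>\<sigma>. v \<sigma> \<ge> 0" and a: "thiele_sequence v a"
    and x: "x \<in> open_simplex" "balanced v x"
    and \<tau>: "\<tau> \<noteq> {}" "v \<tau> > 0"
  shows "(\<lambda>k. set_value (seat_proportions a k) \<tau>) \<longlonglongrightarrow> set_value x \<tau>"
proof -
  define s where "s = (\<lambda>k \<sigma>. real (\<Sum>i\<in>\<sigma>. seats a k i) + 1)"
  define E where "E = (\<lambda>k. \<Sum>\<sigma> | \<sigma> \<noteq> {}. v \<sigma> * ln (real k * set_value x \<sigma> / s k \<sigma>))"
  define b where "b = (\<lambda>k. \<Sum>\<sigma> | \<sigma> \<noteq> {}. v \<sigma> * (2 / s k \<sigma>))"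
  have s: "s k \<sigma> \<ge> 1" for k \<sigma> by (simp add: s_def del: of_nat_sum)
  have dec: "decseq b"
    unfolding b_def decseq_Suc_iff
  proof (intro allI sum_mono mult_left_mono v)
    fix k \<sigma>
    have "s k \<sigma> \<le> s (Suc k) \<sigma>" by (simp add: s_def sum_seats_Suc del: of_nat_sum)
    then show "2 / s (Suc k) \<sigma> \<le> 2 / s k \<sigma>"
      using s[of k \<sigma>] by (intro divide_left_mono) auto
  qed
  have "convergent b"
  proof -
    have "b k \<ge> 0" for k
      unfolding b_def using v s
      by (intro sum_nonneg mult_nonneg_nonneg divide_nonneg_nonneg) (auto intro: order_trans[of 0 1])
    then obtain L where "b \<longlonglongrightarrow> L" using decseq_convergent[OF dec] by blast
    then show ?thesis by (auto simp: convergent_def)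
  qed
  have E_less: "\<forall>\<^sub>F k in sequentially. E k < \<epsilon>" if "\<epsilon> > 0" for \<epsilon>
    using thiele_entropy_step[OF v a x(1)] dec \<open>convergent b\<close> that
    unfolding E_def b_def s_def by (rule damped_recursion_eventually_less)
  \<comment> \<open>The reciprocal of the ratio inside the logarithm of \<open>E\<close>, so that
    the weighted sum of \<open>ln (t k \<sigma>)\<close> is \<open>- E k\<close>.\<close>
  define t where "t = (\<lambda>k \<sigma>. s k \<sigma> / (real k * set_value x \<sigma>))"
  define B where "B = (\<Sum>\<sigma> | \<sigma> \<noteq> {}. v \<sigma> / set_value x \<sigma>)"
  have sq_le: "v \<tau> * (sqrt (t k \<tau>) - 1)\<^sup>2 \<le> E k + B / real k" if k: "k \<ge> 1" for k
  proof -
    have t_pos: "t k \<sigma> > 0" if "\<sigma> \<noteq> {}" for \<sigma>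
      using set_value_pos[OF x(1) that] s[of k \<sigma>] k unfolding t_def
      by (intro divide_pos_pos mult_pos_pos) auto
    have "v \<tau> * (sqrt (t k \<tau>) - 1)\<^sup>2 \<le> (\<Sum>\<sigma> | \<sigma> \<noteq> {}. v \<sigma> * (sqrt (t k \<sigma>) - 1)\<^sup>2)"
      using v \<tau>(1) by (intro member_le_sum) auto
    also have "\<dots> \<le> (\<Sum>\<sigma> | \<sigma> \<noteq> {}. v \<sigma> * (t k \<sigma> - 1 - ln (t k \<sigma>)))"
    proof (intro sum_mono mult_left_mono v)
      fix \<sigma> :: "'n set" assume "\<sigma> \<in> {\<sigma>. \<sigma> \<noteq> {}}"
      then show "(sqrt (t k \<sigma>) - 1)\<^sup>2 \<le> t k \<sigma> - 1 - ln (t k \<sigma>)"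
        using ln_le_minus_sqrt_square[OF t_pos, of \<sigma>] by simp
    qed
    also have "\<dots> = (\<Sum>\<sigma> | \<sigma> \<noteq> {}. v \<sigma> * t k \<sigma>) - (\<Sum>\<sigma> | \<sigma> \<noteq> {}. v \<sigma>)
        - (\<Sum>\<sigma> | \<sigma> \<noteq> {}. v \<sigma> * ln (t k \<sigma>))"
      by (simp add: right_diff_distrib sum_subtractf)
    also have "(\<Sum>\<sigma> | \<sigma> \<noteq> {}. v \<sigma> * ln (t k \<sigma>)) = - E k"
      unfolding E_def sum_negf[symmetric]
    proof (intro sum.cong refl)
      fix \<sigma> :: "'n set" assume "\<sigma> \<in> {\<sigma>. \<sigma> \<noteq> {}}"
      then have "ln (inverse (t k \<sigma>)) = - ln (t k \<sigma>)" using t_pos by (simp add: ln_inverse)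
      then show "v \<sigma> * ln (t k \<sigma>) = - (v \<sigma> * ln (real k * set_value x \<sigma> / s k \<sigma>))"
        by (simp add: t_def)
    qed
    \<comment> \<open>Since \<open>s\<close> is the seat count plus 1, the seats contribute the
      balanced sum and the extra 1 contributes \<open>B / k\<close>.\<close>
    also have "(\<Sum>\<sigma> | \<sigma> \<noteq> {}. v \<sigma> * t k \<sigma>) = (\<Sum>\<sigma> | \<sigma> \<noteq> {}. v \<sigma>) + B / real k"
    proof -
      have "(\<Sum>\<sigma> | \<sigma> \<noteq> {}. v \<sigma> * t k \<sigma>)
          = (\<Sum>\<sigma> | \<sigma> \<noteq> {}. v \<sigma> / set_value x \<sigma> * set_value (seat_proportions a k) \<sigma>) + B / real k"
        unfolding B_def sum_divide_distrib sum.distrib[symmetric]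
        by (intro sum.cong refl)
          (simp add: t_def s_def set_value_seat_proportions add_divide_distrib distrib_left mult.commute)
      also have "(\<Sum>i\<in>UNIV. seat_proportions a k $ i) = 1"
        using set_value_seat_proportions[of a k UNIV] k
        by (simp add: sum_seats_UNIV set_value_def del: of_nat_sum)
      then have "(\<Sum>\<sigma> | \<sigma> \<noteq> {}. v \<sigma> / set_value x \<sigma> * set_value (seat_proportions a k) \<sigma>)
          = (\<Sum>\<sigma> | \<sigma> \<noteq> {}. v \<sigma>)"
        by (rule balanced_weighted_sum[OF x])
      finally show ?thesis .
    qed
    finally show ?thesis by simp
  qed
  have "(\<lambda>k. v \<tau> * (sqrt (t k \<tau>) - 1)\<^sup>2) \<longlonglongrightarrow> 0"
  proof (rule order_tendstoI)
    fix y :: real assume "y < 0"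
    then show "\<forall>\<^sub>F k in sequentially. y < v \<tau> * (sqrt (t k \<tau>) - 1)\<^sup>2"
      using v by (intro always_eventually allI) (auto intro: less_le_trans)
  next
    fix y :: real assume y: "0 < y"
    have "(\<lambda>k. B / real k) \<longlonglongrightarrow> 0" by (rule lim_const_over_n)
    then have "\<forall>\<^sub>F k in sequentially. B / real k < y / 2"
      using y by (intro order_tendstoD(2)) auto
    with E_less[OF half_gt_zero[OF y]] eventually_ge_at_top[of 1]
    show "\<forall>\<^sub>F k in sequentially. v \<tau> * (sqrt (t k \<tau>) - 1)\<^sup>2 < y"
    proof eventually_elim
      case (elim k)
      then show ?case using sq_le[of k] by linarith
    qed
  qed
  from tendsto_mult[OF tendsto_const[of "1 / v \<tau>"] this]
  have "(\<lambda>k. (sqrt (t k \<tau>) - 1)\<^sup>2) \<longlonglongrightarrow> 0" using \<tau>(2) by simp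
  then have "(\<lambda>k. sqrt (t k \<tau>) - 1) \<longlonglongrightarrow> 0"
    using tendsto_real_sqrt[of "\<lambda>k. (sqrt (t k \<tau>) - 1)\<^sup>2" 0 sequentially]
    by (simp add: tendsto_rabs_zero_iff)
  then have "(\<lambda>k. (sqrt (t k \<tau>) - 1 + 1)\<^sup>2) \<longlonglongrightarrow> (0 + 1)\<^sup>2"
    by (intro tendsto_intros)
  then have "(\<lambda>k. t k \<tau>) \<longlonglongrightarrow> 1"
  proof -
    have "(sqrt (t k \<tau>))\<^sup>2 = t k \<tau>" for k
      using set_value_pos[OF x(1) \<tau>(1)] s[of k \<tau>] by (simp add: t_def)
    with \<open>(\<lambda>k. (sqrt (t k \<tau>) - 1 + 1)\<^sup>2) \<longlonglongrightarrow> (0 + 1)\<^sup>2\<close> show ?thesis by simp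
  qed
  then have "(\<lambda>k. set_value x \<tau> * t k \<tau> - 1 / real k) \<longlonglongrightarrow> set_value x \<tau> * 1 - 0"
    by (intro tendsto_intros lim_const_over_n)
  \<comment> \<open>This removes the shift by 1 in \<open>s\<close>. At \<open>k = 0\<close> both
    sides are 0, as division by 0 yields 0.\<close>
  moreover have "set_value x \<tau> * t k \<tau> - 1 / real k = set_value (seat_proportions a k) \<tau>" for k
    using set_value_pos[OF x(1) \<tau>(1)]
    by (simp add: t_def s_def set_value_seat_proportions add_divide_distrib distrib_left)
  ultimately show ?thesis by simp
qed

section \<open>From set values to the limit point\<close>

text \<open>Uniqueness speaks of interior points only, whereas \<open>q\<close> may lie on the
  boundary. Averaging with \<open>x\<close> moves it inside and keeps every set value that carries
  votes.\<close>

lemma balanced_unique_set_values: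
  fixes v :: "'n::finite set \<Rightarrow> real" and x q :: "real ^ 'n"
  assumes x: "x \<in> open_simplex" "balanced v x"
    and unique: "\<And>y. y \<in> open_simplex \<Longrightarrow> balanced v y \<Longrightarrow> y = x"
    and q: "\<And>i. q $ i \<ge> 0" "(\<Sum>i\<in>UNIV. q $ i) = 1"
    and eq: "\<And>\<sigma>. \<sigma> \<noteq> {} \<Longrightarrow> v \<sigma> \<noteq> 0 \<Longrightarrow> set_value q \<sigma> = set_value x \<sigma>"
  shows "q = x"
proof -
  define y where "y = (1 / 2) *\<^sub>R (x + q)"
  have y_nth: "y $ i = (x $ i + q $ i) / 2" for i by (simp add: y_def)
  have "y \<in> open_simplex"
    using x(1) q by (auto simp: open_simplex_def y_nth sum_divide_distrib[symmetric] sum.distrib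
        intro: add_pos_nonneg)
  moreover have "v \<sigma> / set_value y \<sigma> = v \<sigma> / set_value x \<sigma>" if "\<sigma> \<noteq> {}" for \<sigma>
  proof -
    have "set_value y \<sigma> = (set_value x \<sigma> + set_value q \<sigma>) / 2"
      by (simp add: set_value_def y_nth sum_divide_distrib[symmetric] sum.distrib)
    \<comment> \<open>Without votes both quotients vanish, so agreement on sets with votes
      suffices.\<close>
    then show ?thesis using eq[OF that] by (cases "v \<sigma> = 0") auto
  qed
  then have "(\<Sum>\<sigma> | i \<in> \<sigma>. v \<sigma> / set_value y \<sigma>) = (\<Sum>\<sigma> | i \<in> \<sigma>. v \<sigma> / set_value x \<sigma>)" for i
    by (intro sum.cong) auto
  then have "balanced v y"
    using x(2) by (simp add: balanced_def)
  ultimately have "y = x" by (rule unique)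
  have "q $ i = x $ i" for i
    using y_nth[of i] \<open>y = x\<close> by simp
  then show ?thesis by (simp add: vec_eq_iff)
qed

text \<open>Otherwise some subsequence in \<open>S\<close> stays at distance at least
  \<open>e\<close> from \<open>x\<close>; by compactness it has a further subsequence with a limit
  in \<open>S\<close>, which must be \<open>x\<close>.\<close>

lemma tendsto_compactI:
  fixes f :: "nat \<Rightarrow> 'a::metric_space"
  assumes "compact S" and in_S: "\<forall>\<^sub>F n in sequentially. f n \<in> S"
    and limit: "\<And>r l. strict_mono r \<Longrightarrow> (f \<circ> r) \<longlonglongrightarrow> l \<Longrightarrow> l \<in> S \<Longrightarrow> l = x"
  shows "f \<longlonglongrightarrow> x"
proof (rule ccontr)
  assume "\<not> f \<longlonglongrightarrow> x"
  then obtain e where "e > 0" and e: "\<exists>\<^sub>F n in sequentially. \<not> dist (f n) x < e"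
    unfolding tendsto_iff not_eventually[symmetric] by blast
  from frequently_eventually_frequently[OF e in_S]
  have "infinite {n. \<not> dist (f n) x < e \<and> f n \<in> S}"
    by (simp add: cofinite_eq_sequentially[symmetric] frequently_cofinite)
  then obtain r :: "nat \<Rightarrow> nat"
    where r: "strict_mono r" "\<And>n. \<not> dist (f (r n)) x < e \<and> f (r n) \<in> S"
    using infinite_enumerate by blast
  then obtain l r' where l: "l \<in> S" "strict_mono r'" "(f \<circ> r \<circ> r') \<longlonglongrightarrow> l"
    using \<open>compact S\<close> unfolding compact_def by (metis comp_apply)
  have "l = x"
    using limit[of "r \<circ> r'" l] l r(1) by (simp add: strict_mono_o comp_assoc)
  with l(3) \<open>e > 0\<close> have "\<forall>\<^sub>F n in sequentially. dist ((f \<circ> r \<circ> r') n) x < e"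
    by (simp add: tendsto_iff)
  then show False using r(2) by simp
qed

theorem theorem12p2:
  fixes v :: "'n::finite set \<Rightarrow> real"
    and a :: "nat \<Rightarrow> 'n"
    and x0 :: "real ^ 'n"
  assumes "\<And>\<sigma>. v \<sigma> \<ge> 0"
    and "thiele_sequence v a"
    and "x0 \<in> open_simplex" and "balanced v x0"
    and "\<And>x. x \<in> open_simplex \<Longrightarrow> balanced v x \<Longrightarrow> x = x0"
  shows "(\<lambda>n. seat_proportions a n) \<longlonglongrightarrow> x0"
proof (rule tendsto_compactI)
  let ?S = "{q :: real ^ 'n. (\<forall>i. q $ i \<ge> 0) \<and> (\<Sum>i\<in>UNIV. q $ i) = 1}"
  have "closed ?S"
    by (intro closed_Collect_conj closed_Collect_all closed_Collect_le closed_Collect_eq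
        continuous_intros)
  moreover have "bounded ?S"
    unfolding bounded_iff
  proof (intro exI ballI)
    fix q :: "real ^ 'n" assume "q \<in> ?S"
    then show "norm q \<le> 1" using norm_le_l1_cart[of q] by simp
  qed
  ultimately show "compact ?S" by (simp add: compact_eq_bounded_closed)
  \<comment> \<open>Only from \<open>n = 1\<close> on: for \<open>n = 0\<close> the proportions form
    the zero vector.\<close>
  show "\<forall>\<^sub>F n in sequentially. seat_proportions a n \<in> ?S"
    using eventually_ge_at_top[of 1]
  proof eventually_elim
    case (elim n)
    then show ?case
      using set_value_seat_proportions[of a n UNIV]
      by (simp add: sum_seats_UNIV set_value_def seat_proportions_def del: of_nat_sum)
  qed
  fix r :: "nat \<Rightarrow> nat" and q :: "real ^ 'n"
  assume r: "strict_mono r" and lim: "(seat_proportions a \<circ> r) \<longlonglongrightarrow> q" and q: "q \<in> ?S"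
  show "q = x0"
  \<comment> \<open>Along the subsequence the set values tend to those of \<open>q\<close> by
    continuity and, where there are votes, to those of \<open>x0\<close> by the entropy
    bound.\<close>
  proof (rule balanced_unique_set_values[OF assms(3-5)])
    fix \<sigma> :: "'n set" assume \<sigma>: "\<sigma> \<noteq> {}" "v \<sigma> \<noteq> 0"
    then have "(\<lambda>k. set_value (seat_proportions a k) \<sigma>) \<longlonglongrightarrow> set_value x0 \<sigma>"
      using assms(1)[of \<sigma>] by (intro thiele_set_value_tendsto[OF assms(1-4)]) auto
    from LIMSEQ_subseq_LIMSEQ[OF this r]
    have "(\<lambda>k. set_value ((seat_proportions a \<circ> r) k) \<sigma>) \<longlonglongrightarrow> set_value x0 \<sigma>"
      by (simp add: comp_def)
    moreover have "(\<lambda>k. set_value ((seat_proportions a \<circ> r) k) \<sigma>) \<longlonglongrightarrow> set_value q \<sigma>"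
      unfolding set_value_def by (intro tendsto_intros lim)
    ultimately show "set_value q \<sigma> = set_value x0 \<sigma>" by (rule LIMSEQ_unique[symmetric])
  qed (use q in auto)
qed

end
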